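(* Let $X$ be an arbitrary set with at least three elements, let $\mathcal{P}=\{X_i \mid i\in I\}$ be a partition of $X$, and let $f\in\Gamma(X,\mathcal{P})$. Then $f$ is a regular element of the semigroup $\Gamma(X,\mathcal{P})$ if and only if for every $j\in I\chi^{(f)}$ there exists $i\in I$ such that $f$ induces a block map $f_i\colon X_i\to X_j$ in the family $B(f,I)$ (so $i\chi^{(f)}=j$) and this block map $f_i$ is injective.
   Context: Maps are written on the right and composed from left to right: $xf$ is the image of $x$ under $f$, $x(fg)=(xf)g$, and $Af$ is the image of a subset $A$ under $f$. A partition of $X$ is a collection of nonempty pairwise disjoint subsets (blocks) with union $X$; distinct indices correspond to distinct blocks. $\mathcal{T}_X$ is the semigroup of all maps $X\to X$ under composition. $\Gamma(X,\mathcal{P})=\{f\in\mathcal{T}_X \mid (\forall X_i\in\mathcal{P})(\exists X_j\in\mathcal{P})\; X_if=X_j\}$, a semigroup under composition containing the identity map. For $f\in\Gamma(X,\mathcal{P})$, the character $\chi^{(f)}\colon I\to I$ is defined by $i\chi^{(f)}=j$ whenever $X_if\subseteq X_j$ (equivalently here, $X_if=X_j$); $I\chi^{(f)}$ is its image. A block map is a map whose domain and codomain are blocks of $\mathcal{P}$. For each $i\in I$, $f_i$ is the block map with domain $X_i$ and codomain $X_{i\chi^{(f)}}$ induced by $f$, i.e. $xf_i=xf$ for $x\in X_i$; $B(f,I)=\{f_i \mid i\in I\}$ is the indexed family of these. An element $a$ of a semigroup $S$ is regular if there is $b\in S$ with $a=aba$. *)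

theory Defs
  imports "HOL-Algebra.Group" "HOL-Library.Disjoint_Sets"
begin

definition indexed_partition :: "'a set \<Rightarrow> 'i set \<Rightarrow> ('i \<Rightarrow> 'a set) \<Rightarrow> bool" where
  "indexed_partition X I P \<longleftrightarrow> partition_on X (P ` I) \<and> inj_on P I"

text \<open>Maps are written on the right in the source, so the product \<open>f g\<close> is ``first \<open>f\<close>, then \<open>g\<close>''.
  Maps \<open>X \<rightarrow> X\<close> are extensional, so that equality of semigroup elements is equality of maps on \<open>X\<close>.\<close>

definition full_transformation_monoid :: "'a set \<Rightarrow> ('a \<Rightarrow> 'a) monoid" where
  "full_transformation_monoid X =
     \<lparr>carrier = X \<rightarrow>\<^sub>E X, mult = (\<lambda>f g. compose X g f), one = (\<lambda>x\<in>X. x)\<rparr>"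

definition Gamma_monoid :: "'a set \<Rightarrow> 'i set \<Rightarrow> ('i \<Rightarrow> 'a set) \<Rightarrow> ('a \<Rightarrow> 'a) monoid" where
  "Gamma_monoid X I P =
     (full_transformation_monoid X)
       \<lparr>carrier := {f \<in> carrier (full_transformation_monoid X).
                     \<forall>i\<in>I. \<exists>j\<in>I. f ` P i = P j}\<rparr>"

definition regular_element :: "('a, 'b) monoid_scheme \<Rightarrow> 'a \<Rightarrow> bool" where
  "regular_element S a \<longleftrightarrow>
     a \<in> carrier S \<and> (\<exists>b\<in>carrier S. a = a \<otimes>\<^bsub>S\<^esub> b \<otimes>\<^bsub>S\<^esub> a)"

text \<open>The description is well defined when \<open>P\<close> is an indexed partition and \<open>f\<close> lies in
  \<open>Gamma_monoid X I P\<close>; see \<open>ex1_character\<close> below.\<close>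

definition character :: "'i set \<Rightarrow> ('i \<Rightarrow> 'a set) \<Rightarrow> ('a \<Rightarrow> 'a) \<Rightarrow> 'i \<Rightarrow> 'i" where
  "character I P f = (\<lambda>i\<in>I. THE j. j \<in> I \<and> f ` P i \<subseteq> P j)"

record 'a block_map =
  bm_dom :: "'a set"
  bm_cod :: "'a set"
  bm_fun :: "'a \<Rightarrow> 'a"

definition block_map_inj :: "'a block_map \<Rightarrow> bool" where
  "block_map_inj b \<longleftrightarrow> inj_on (bm_fun b) (bm_dom b)"

text \<open>The indexed family \<open>B(f, I)\<close>, whose member at \<open>i\<close> is \<open>f\<^sub>i\<close>.\<close>

definition block_family ::
    "'i set \<Rightarrow> ('i \<Rightarrow> 'a set) \<Rightarrow> ('a \<Rightarrow> 'a) \<Rightarrow> 'i \<Rightarrow> 'a block_map" where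
  "block_family I P f =
     (\<lambda>i\<in>I. \<lparr>bm_dom = P i, bm_cod = P (character I P f i), bm_fun = restrict f (P i)\<rparr>)"

lemma monoid_Gamma_monoid:
  assumes "indexed_partition X I P"
  shows "monoid (Gamma_monoid X I P)"
proof -
  have sub: "P i \<subseteq> X" if "i \<in> I" for i
    using assms that by (auto simp: indexed_partition_def partition_on_def)
  have comp: "\<exists>k\<in>I. compose X g f ` P i = P k"
    if "\<forall>i\<in>I. \<exists>j\<in>I. f ` P i = P j" "\<forall>i\<in>I. \<exists>j\<in>I. g ` P i = P j" "i \<in> I" for f g i
  proof -
    have "compose X g f ` P i = g ` f ` P i"
      using sub[OF that(3)] by (force simp: compose_def image_image)
    then show ?thesis using that by metis
  qed
  have ident: "(\<lambda>x\<in>X. x) ` P i = P i" if "i \<in> I" for i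
    using sub[OF that] by (force simp: image_def)
  have one: "(\<lambda>x\<in>X. x) \<in> carrier (Gamma_monoid X I P)"
    using ident by (auto simp: Gamma_monoid_def full_transformation_monoid_def)
  have mult: "compose X g f \<in> carrier (Gamma_monoid X I P)"
    if "f \<in> carrier (Gamma_monoid X I P)" "g \<in> carrier (Gamma_monoid X I P)" for f g
    using that comp[of f g]
    by (auto simp: Gamma_monoid_def full_transformation_monoid_def PiE_iff compose_def Pi_iff)
  show ?thesis
  proof (rule monoidI, goal_cases)
    case (1 f g)
    then show ?case using mult[of f g]
      by (simp add: Gamma_monoid_def full_transformation_monoid_def)
  next
    case 2
    show ?case using one by (simp add: Gamma_monoid_def full_transformation_monoid_def)
  qed (auto simp: Gamma_monoid_def full_transformation_monoid_def compose_def PiE_iff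
        extensional_def Pi_iff fun_eq_iff)
qed

lemma ex1_character:
  assumes P: "indexed_partition X I P" and f: "f \<in> carrier (Gamma_monoid X I P)" and i: "i \<in> I"
  shows "\<exists>!j. j \<in> I \<and> f ` P i \<subseteq> P j"
proof -
  obtain j where j: "j \<in> I" "f ` P i = P j"
    using f i by (auto simp: Gamma_monoid_def)
  have ne: "P j \<noteq> {}"
    using P j(1) by (auto simp: indexed_partition_def partition_on_def)
  have "k = j" if "k \<in> I" "P j \<subseteq> P k" for k
  proof (rule ccontr)
    assume "k \<noteq> j"
    then have "P k \<inter> P j = {}"
      using P j(1) that(1)
      by (meson indexed_partition_def partition_on_def disjointD imageI inj_onD)
    with that(2) ne show False by blast
  qed
  then show ?thesis using j by (intro ex1I[of _ j]) auto
qed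

end

theory Submission
  imports Defs
begin

text \<open>
  An equation \<open>f = f b f\<close> says that \<open>b\<close> followed by \<open>f\<close> fixes every point of \<open>X f\<close>, that is,
  \<open>b\<close> restricts to a section of \<open>f\<close> over its image. Both implications compare such sections with
  transversals of \<open>f\<close> that are made of whole blocks.

  If \<open>b\<close> lies in \<open>\<Gamma>(X, P)\<close>, it carries a block \<open>X\<^sub>j\<close> in the image of \<open>f\<close> onto a whole block
  \<open>X\<^sub>k\<close>. Since \<open>b\<close> followed by \<open>f\<close> is the identity on \<open>X\<^sub>j\<close>, the map \<open>f\<close> inverts \<open>b\<close> on \<open>X\<^sub>k\<close>, so
  it is injective there with image \<open>X\<^sub>j\<close> (\<open>inner_inverse_gives_injective_block\<close>).

  Conversely, choose for each block in the image of \<open>f\<close> one block on which \<open>f\<close> is injective and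
  which lies above it. Blocks with different images have disjoint images, so \<open>f\<close> is injective on the
  union \<open>U\<close> of the chosen blocks, and \<open>f\<close> maps \<open>U\<close> onto \<open>X f\<close>. The inverse of this bijection,
  completed by the identity outside \<open>X f\<close>, sends blocks to blocks and is the required \<open>b\<close>
  (\<open>injective_blocks_give_regular\<close>).
\<close>

lemma carrier_Gamma_monoid:
  "f \<in> carrier (Gamma_monoid X I P) \<longleftrightarrow> f \<in> X \<rightarrow>\<^sub>E X \<and> (\<forall>i\<in>I. \<exists>j\<in>I. f ` P i = P j)"
  by (simp add: Gamma_monoid_def full_transformation_monoid_def)

lemma mult_Gamma_monoid: "f \<otimes>\<^bsub>Gamma_monoid X I P\<^esub> g = compose X g f"
  by (simp add: Gamma_monoid_def full_transformation_monoid_def)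

lemma regular_Gamma_monoid_iff:
  assumes f: "f \<in> carrier (Gamma_monoid X I P)"
  shows "regular_element (Gamma_monoid X I P) f \<longleftrightarrow>
    (\<exists>b \<in> carrier (Gamma_monoid X I P). \<forall>x\<in>X. f (b (f x)) = f x)"
proof -
  have ext: "f \<in> extensional X"
    using f by (auto simp: carrier_Gamma_monoid PiE_def)
  have "f = compose X f (compose X b f) \<longleftrightarrow> (\<forall>x\<in>X. f (b (f x)) = f x)" for b
  proof
    assume eq: "f = compose X f (compose X b f)"
    show "\<forall>x\<in>X. f (b (f x)) = f x"
    proof
      fix x assume "x \<in> X"
      then show "f (b (f x)) = f x"
        using fun_cong[OF eq, of x] by (simp add: compose_eq)
    qed
  next
    assume "\<forall>x\<in>X. f (b (f x)) = f x"
    then show "f = compose X f (compose X b f)"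
      by (intro extensionalityI[OF ext compose_extensional]) (simp add: compose_eq)
  qed
  then show ?thesis
    using f by (simp add: regular_element_def mult_Gamma_monoid)
qed

lemma indexed_partition_subset: "indexed_partition X I P \<Longrightarrow> i \<in> I \<Longrightarrow> P i \<subseteq> X"
  by (auto simp: indexed_partition_def partition_on_def)

lemma indexed_partition_eqI:
  assumes "indexed_partition X I P" "i \<in> I" "j \<in> I" "x \<in> P i" "x \<in> P j"
  shows "i = j"
proof -
  have "P i = P j"
    using assms disjointD[of "P ` I" "P i" "P j"]
    by (auto simp: indexed_partition_def partition_on_def)
  then show ?thesis
    using assms(1,2,3) by (auto simp: indexed_partition_def dest: inj_onD)
qed

lemma character_in_index_set:
  assumes "indexed_partition X I P" "f \<in> carrier (Gamma_monoid X I P)" "i \<in> I"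
  shows "character I P f i \<in> I"
  using theI'[OF ex1_character[OF assms]] assms(3) by (simp add: character_def)

lemma image_block_eq_character:
  assumes P: "indexed_partition X I P" and f: "f \<in> carrier (Gamma_monoid X I P)" and i: "i \<in> I"
  shows "f ` P i = P (character I P f i)"
proof -
  obtain j where j: "j \<in> I" "f ` P i = P j"
    using f i by (auto simp: carrier_Gamma_monoid)
  then have "(THE j. j \<in> I \<and> f ` P i \<subseteq> P j) = j"
    using ex1_character[OF P f i] by (intro the1_equality) auto
  then show ?thesis
    using i j(2) by (simp add: character_def)
qed

text \<open>The block is the image under \<open>b\<close> of the block \<open>f ` P i\<close>: there \<open>f\<close> undoes \<open>b\<close>.\<close>

lemma inner_inverse_gives_injective_block:
  assumes P: "indexed_partition X I P"
    and f: "f \<in> carrier (Gamma_monoid X I P)" and b: "b \<in> carrier (Gamma_monoid X I P)"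
    and fbf: "\<forall>x\<in>X. f (b (f x)) = f x" and i: "i \<in> I"
  shows "\<exists>k\<in>I. f ` P k = f ` P i \<and> inj_on f (P k)"
proof -
  obtain j where j: "j \<in> I" "f ` P i = P j"
    using f i by (auto simp: carrier_Gamma_monoid)
  obtain k where k: "k \<in> I" "b ` P j = P k"
    using b j(1) by (auto simp: carrier_Gamma_monoid)
  have undo: "f (b y) = y" if y: "y \<in> P j" for y
  proof -
    obtain x where "x \<in> P i" "y = f x"
      using y j(2) by auto
    then show ?thesis
      using fbf indexed_partition_subset[OF P i] by auto
  qed
  have "f ` P k = P j"
    unfolding k(2)[symmetric] using undo by (simp add: image_image)
  moreover have "inj_on f (P k)"
    unfolding k(2)[symmetric] using undo by (auto intro!: inj_onI)
  ultimately show ?thesis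
    using j(2) k(1) by auto
qed

text \<open>
  The inner inverse is glued from the inverses of the injective restrictions of \<open>f\<close>. Outside the
  image of \<open>f\<close> its values do not affect \<open>f b f\<close>, but blocks must still go to blocks; the identity
  achieves this because the image of \<open>f\<close> is a union of blocks, so no block meets it only partly.
\<close>

lemma injective_blocks_give_regular:
  assumes P: "indexed_partition X I P" and f: "f \<in> carrier (Gamma_monoid X I P)"
    and inj: "\<And>i. i \<in> I \<Longrightarrow> \<exists>k\<in>I. f ` P k = f ` P i \<and> inj_on f (P k)"
  shows "regular_element (Gamma_monoid X I P) f"
proof -
  have X: "X = (\<Union>i\<in>I. P i)"
    using P by (auto simp: indexed_partition_def partition_on_def)
  define J where "J = {j \<in> I. \<exists>i\<in>I. f ` P i = P j}"
  have "\<exists>k\<in>I. f ` P k = P j \<and> inj_on f (P k)" if "j \<in> J" for j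
  proof -
    obtain i where "i \<in> I" "f ` P i = P j"
      using \<open>j \<in> J\<close> by (auto simp: J_def)
    then show ?thesis
      using inj[of i] by simp
  qed
  then obtain c where c: "\<And>j. j \<in> J \<Longrightarrow> c j \<in> I \<and> f ` P (c j) = P j \<and> inj_on f (P (c j))"
    by metis
  define U where "U = (\<Union>j\<in>J. P (c j))"
  have U_X: "U \<subseteq> X"
    using c by (auto simp: U_def X)
  have f_X: "f ` X = (\<Union>j\<in>J. P j)"
  proof
    show "f ` X \<subseteq> (\<Union>j\<in>J. P j)"
    proof
      fix y assume "y \<in> f ` X"
      then obtain i where i: "i \<in> I" "y \<in> f ` P i"
        unfolding X by blast
      moreover obtain j where "j \<in> I" "f ` P i = P j"
        using f i(1) by (auto simp: carrier_Gamma_monoid)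
      ultimately show "y \<in> (\<Union>j\<in>J. P j)"
        unfolding J_def by blast
    qed
    show "(\<Union>j\<in>J. P j) \<subseteq> f ` X"
    proof (rule UN_least)
      fix j assume "j \<in> J"
      then have "c j \<in> I" "f ` P (c j) = P j"
        using c by blast+
      then show "P j \<subseteq> f ` X"
        unfolding X by blast
    qed
  qed
  have f_U: "f ` U = f ` X"
    using c by (simp add: U_def image_UN f_X)
  have inj_U: "inj_on f U"
  proof (rule inj_onI)
    fix x y assume "x \<in> U" "y \<in> U" and eq: "f x = f y"
    then obtain j l where jl: "j \<in> J" "x \<in> P (c j)" "l \<in> J" "y \<in> P (c l)"
      by (auto simp: U_def)
    then have "f x \<in> P j" "f x \<in> P l"
      using c eq by (metis imageI)+
    then have "j = l"
      using jl indexed_partition_eqI[OF P] by (simp add: J_def)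
    then show "x = y"
      using jl c eq by (meson inj_onD)
  qed
  define b where "b = (\<lambda>x\<in>X. if x \<in> f ` X then inv_into U f x else x)"
  have fX_X: "f ` X \<subseteq> X"
    using f by (auto simp: carrier_Gamma_monoid)
  have b_fX: "b y = inv_into U f y" if "y \<in> f ` X" for y
    using that fX_X by (auto simp: b_def)
  have b_block: "\<exists>k\<in>I. b ` P j = P k" if j: "j \<in> I" for j
  proof (cases "j \<in> J")
    case True
    have "b ` P j = inv_into U f ` P j"
      using True by (intro image_cong refl b_fX) (auto simp: f_X)
    also have "\<dots> = inv_into U f ` f ` P (c j)"
      using c[OF True] by simp
    also have "\<dots> = P (c j)"
      using True by (intro inv_into_image_cancel[OF inj_U]) (auto simp: U_def)
    finally show ?thesis
      using c[OF True] by blast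
  next
    case False
    have "x \<notin> f ` X" if x: "x \<in> P j" for x
    proof
      assume "x \<in> f ` X"
      then obtain l where "l \<in> J" "x \<in> P l"
        unfolding f_X by blast
      then have "l = j"
        using x j indexed_partition_eqI[OF P] by (simp add: J_def)
      then show False
        using False \<open>l \<in> J\<close> by simp
    qed
    then have "b ` P j = P j"
      using indexed_partition_subset[OF P j] by (force simp: b_def)
    then show ?thesis
      using j by blast
  qed
  have "b x \<in> X" if "x \<in> X" for x
    using that U_X f_U inv_into_into[of x f U] by (auto simp: b_def)
  then have "b \<in> carrier (Gamma_monoid X I P)"
    using b_block by (auto simp: carrier_Gamma_monoid b_def)
  moreover have "\<forall>x\<in>X. f (b (f x)) = f x"
    using f_U by (simp add: b_fX f_inv_into_f)
  ultimately show ?thesis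
    using regular_Gamma_monoid_iff[OF f] by blast
qed

theorem theorem5p5:
  fixes X :: "'a set" and I :: "'i set" and P :: "'i \<Rightarrow> 'a set" and f :: "'a \<Rightarrow> 'a"
  assumes "infinite X \<or> 3 \<le> card X"
    and "indexed_partition X I P"
    and "f \<in> carrier (Gamma_monoid X I P)"
  shows "regular_element (Gamma_monoid X I P) f \<longleftrightarrow>
    (\<forall>j \<in> character I P f ` I. \<exists>i\<in>I.
       character I P f i = j \<and>
       bm_dom (block_family I P f i) = P i \<and> bm_cod (block_family I P f i) = P j \<and>
       block_map_inj (block_family I P f i))"
proof -
  note P = assms(2) and f = assms(3)
  \<comment> \<open>Distinct indices have distinct blocks, so equality of characters is equality of image blocks.\<close>
  have char_eq: "character I P f k = character I P f i \<longleftrightarrow> f ` P k = f ` P i"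
    if "i \<in> I" "k \<in> I" for i k
    using that P character_in_index_set[OF P f] image_block_eq_character[OF P f]
    by (auto simp: indexed_partition_def dest: inj_onD)
  have "regular_element (Gamma_monoid X I P) f \<longleftrightarrow>
      (\<forall>i\<in>I. \<exists>k\<in>I. f ` P k = f ` P i \<and> inj_on f (P k))"
    using inner_inverse_gives_injective_block[OF P f] injective_blocks_give_regular[OF P f]
    by (auto simp: regular_Gamma_monoid_iff[OF f])
  also have "\<dots> \<longleftrightarrow> (\<forall>i\<in>I. \<exists>k\<in>I. character I P f k = character I P f i \<and> inj_on f (P k))"
    using char_eq by (intro ball_cong bex_cong refl) auto
  also have "\<dots> \<longleftrightarrow> (\<forall>j \<in> character I P f ` I. \<exists>i\<in>I.
       character I P f i = j \<and>
       bm_dom (block_family I P f i) = P i \<and> bm_cod (block_family I P f i) = P j \<and>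
       block_map_inj (block_family I P f i))"
    by (simp add: block_family_def block_map_inj_def cong: conj_cong bex_cong)
  finally show ?thesis .
qed

end
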